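(* Let $(Q;\cdot)$ be a group isotope, let $0\in Q$, and let $x\cdot y=\alpha x+a+\beta y$ be its ($0$-)canonical decomposition, with decomposition group $(Q;+)$, coefficients $\alpha,\beta$ and free member $a$. Then: 1) $(Q;\cdot)$ is commutative if and only if $(Q;+)$ is abelian and $\beta=\alpha$; 2) $(Q;\cdot)$ is left symmetric if and only if $(Q;+)$ is abelian and $\beta=-\iota$; 3) $(Q;\cdot)$ is right symmetric if and only if $(Q;+)$ is abelian and $\alpha=-\iota$; 4) $(Q;\cdot)$ is totally symmetric if and only if $(Q;+)$ is abelian and $\alpha=\beta=-\iota$; 5) $(Q;\cdot)$ is semi-symmetric if and only if $\alpha$ is an anti-automorphism of $(Q;+)$, $\beta=\alpha^{-1}$, $\alpha^{3}=-I_{a}^{-1}$ and $\alpha a=-a$, where $I_{a}(x):=-a+x+a$; 6) $(Q;\cdot)$ is asymmetric if and only if both of the following hold: (i) $(Q;+)$ is not abelian, or the three inequalities $\alpha\neq-\iota$, $\alpha\neq\beta$, $\beta\neq-\iota$ all hold; and (ii) at least one of the following is true: $\alpha$ is not an anti-automorphism of $(Q;+)$, $\beta\neq\alpha^{-1}$, $\alpha^{3}\neq -I_{a}^{-1}$, $\alpha a\neq -a$.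
   Context: A quasigroup is a groupoid $(Q;\cdot)$ in which each equation $x\cdot a=b$, $a\cdot y=b$ has a unique solution. For $\sigma\in S_3$, the $\sigma$-parastrophe of $(\cdot)$ is the operation $\stackrel{\sigma}{\cdot}$ defined by $x_{1\sigma}\stackrel{\sigma}{\cdot}x_{2\sigma}=x_{3\sigma}\Leftrightarrow x_1\cdot x_2=x_3$. The symmetry group $\mathrm{Sym}(\cdot)$ is the set of $\sigma\in S_3$ with $(\stackrel{\sigma}{\cdot})=(\cdot)$. Put $s=(12)$, $\ell=(13)$, $r=(23)$. A quasigroup is: asymmetric if $\mathrm{Sym}(\cdot)=\{\iota\}$; commutative if $s\in\mathrm{Sym}(\cdot)$ (identity $xy=yx$); left symmetric if $r\in\mathrm{Sym}(\cdot)$ (identity $x\cdot xy=y$); right symmetric if $\ell\in\mathrm{Sym}(\cdot)$ (identity $xy\cdot y=x$); semi-symmetric if $\mathrm{Sym}(\cdot)\supseteq A_3$ (identity $x\cdot yx=y$); totally symmetric if $\mathrm{Sym}(\cdot)=S_3$ (identities $xy=yx$ and $xy\cdot y=x$). A group isotope is a groupoid $(Q;\cdot)$ of the form $x\cdot y=\gamma^{-1}(\alpha x+\beta y)$ for some group $(Q;+)$ (not necessarily commutative) and bijections $\alpha,\beta,\gamma$ of $Q$. A $0$-canonical decomposition of a group isotope $(Q;\cdot)$ is a representation $x\cdot y=\alpha x+a+\beta y$, where $(Q;+)$ is a group with neutral element $0$, $a\in Q$, and $\alpha,\beta$ are permutations of $Q$ with $\alpha(0)=\beta(0)=0$ (for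 each $0\in Q$ such a decomposition exists and is unique). Groups are written additively even when not commutative; $\iota$ is the identity map, and for a map $f$, $-f$ denotes $x\mapsto -(f(x))$; powers of maps are with respect to composition. *)

theory Defs
  imports "HOL-Algebra.Sym_Groups"
begin

definition groupoid_on :: "'a set \<Rightarrow> ('a \<Rightarrow> 'a \<Rightarrow> 'a) \<Rightarrow> bool" where
  "groupoid_on Q f \<longleftrightarrow> (\<forall>x\<in>Q. \<forall>y\<in>Q. f x y \<in> Q)"

definition quasigroup_on :: "'a set \<Rightarrow> ('a \<Rightarrow> 'a \<Rightarrow> 'a) \<Rightarrow> bool" where
  "quasigroup_on Q f \<longleftrightarrow> groupoid_on Q f \<and>
     (\<forall>a\<in>Q. \<forall>b\<in>Q. (\<exists>!x. x \<in> Q \<and> f x a = b) \<and> (\<exists>!y. y \<in> Q \<and> f a y = b))"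

(* A triple (x 1, x 2, x 3) is a function on the indices 1, 2, 3, and a permutation sigma in S_3
   is a function nat => nat permuting {1..3}. The value w at (u, v) is the one with
   x (sigma 1) = u, x (sigma 2) = v, x (sigma 3) = w and f (x 1) (x 2) = x 3;
   it exists and is unique in a quasigroup, and is unspecified by THE otherwise. *)
definition parastrophe ::
    "'a set \<Rightarrow> ('a \<Rightarrow> 'a \<Rightarrow> 'a) \<Rightarrow> (nat \<Rightarrow> nat) \<Rightarrow> 'a \<Rightarrow> 'a \<Rightarrow> 'a" where
  "parastrophe Q f \<sigma> u v =
     (THE w. \<exists>x :: nat \<Rightarrow> 'a. x ` {1..3} \<subseteq> Q \<and>
        x (\<sigma> 1) = u \<and> x (\<sigma> 2) = v \<and> x (\<sigma> 3) = w \<and> f (x 1) (x 2) = x 3)"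

(* Operations on Q are compared by their values on Q only. *)
definition Sym :: "'a set \<Rightarrow> ('a \<Rightarrow> 'a \<Rightarrow> 'a) \<Rightarrow> (nat \<Rightarrow> nat) set" where
  "Sym Q f = {\<sigma> \<in> carrier (sym_group 3). \<forall>u\<in>Q. \<forall>v\<in>Q. parastrophe Q f \<sigma> u v = f u v}"

definition asymmetric :: "'a set \<Rightarrow> ('a \<Rightarrow> 'a \<Rightarrow> 'a) \<Rightarrow> bool" where
  "asymmetric Q f \<longleftrightarrow> quasigroup_on Q f \<and> Sym Q f = {id}"

definition commutative :: "'a set \<Rightarrow> ('a \<Rightarrow> 'a \<Rightarrow> 'a) \<Rightarrow> bool" where
  "commutative Q f \<longleftrightarrow> quasigroup_on Q f \<and> transpose 1 2 \<in> Sym Q f"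

definition left_symmetric :: "'a set \<Rightarrow> ('a \<Rightarrow> 'a \<Rightarrow> 'a) \<Rightarrow> bool" where
  "left_symmetric Q f \<longleftrightarrow> quasigroup_on Q f \<and> transpose 2 3 \<in> Sym Q f"

definition right_symmetric :: "'a set \<Rightarrow> ('a \<Rightarrow> 'a \<Rightarrow> 'a) \<Rightarrow> bool" where
  "right_symmetric Q f \<longleftrightarrow> quasigroup_on Q f \<and> transpose 1 3 \<in> Sym Q f"

definition semi_symmetric :: "'a set \<Rightarrow> ('a \<Rightarrow> 'a \<Rightarrow> 'a) \<Rightarrow> bool" where
  "semi_symmetric Q f \<longleftrightarrow> quasigroup_on Q f \<and> carrier (alt_group 3) \<subseteq> Sym Q f"

definition totally_symmetric :: "'a set \<Rightarrow> ('a \<Rightarrow> 'a \<Rightarrow> 'a) \<Rightarrow> bool" where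
  "totally_symmetric Q f \<longleftrightarrow> quasigroup_on Q f \<and> Sym Q f = carrier (sym_group 3)"

(* Groups are those of HOL-Algebra, hence written multiplicatively, and need not be commutative:
   x + y, 0 and -x of the additive notation are mult G x y, one G and m_inv G x. *)

definition group_isotope :: "'a set \<Rightarrow> ('a \<Rightarrow> 'a \<Rightarrow> 'a) \<Rightarrow> bool" where
  "group_isotope Q f \<longleftrightarrow> groupoid_on Q f \<and>
     (\<exists>(G :: 'a monoid) \<alpha> \<beta> \<gamma>. group G \<and> carrier G = Q \<and>
        bij_betw \<alpha> Q Q \<and> bij_betw \<beta> Q Q \<and> bij_betw \<gamma> Q Q \<and>
        (\<forall>x\<in>Q. \<forall>y\<in>Q. f x y = inv_into Q \<gamma> (\<alpha> x \<otimes>\<^bsub>G\<^esub> \<beta> y)))"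

definition canonical_decomposition ::
    "'a set \<Rightarrow> ('a \<Rightarrow> 'a \<Rightarrow> 'a) \<Rightarrow> 'a \<Rightarrow> 'a monoid \<Rightarrow> ('a \<Rightarrow> 'a) \<Rightarrow> 'a \<Rightarrow> ('a \<Rightarrow> 'a) \<Rightarrow> bool" where
  "canonical_decomposition Q f z G \<alpha> a \<beta> \<longleftrightarrow>
     group G \<and> carrier G = Q \<and> \<one>\<^bsub>G\<^esub> = z \<and> a \<in> Q \<and>
     bij_betw \<alpha> Q Q \<and> bij_betw \<beta> Q Q \<and> \<alpha> z = z \<and> \<beta> z = z \<and>
     (\<forall>x\<in>Q. \<forall>y\<in>Q. f x y = \<alpha> x \<otimes>\<^bsub>G\<^esub> a \<otimes>\<^bsub>G\<^esub> \<beta> y)"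

definition anti_automorphism :: "'a monoid \<Rightarrow> ('a \<Rightarrow> 'a) \<Rightarrow> bool" where
  "anti_automorphism G \<phi> \<longleftrightarrow> bij_betw \<phi> (carrier G) (carrier G) \<and>
     (\<forall>x\<in>carrier G. \<forall>y\<in>carrier G. \<phi> (x \<otimes>\<^bsub>G\<^esub> y) = \<phi> y \<otimes>\<^bsub>G\<^esub> \<phi> x)"

definition inner_map :: "'a monoid \<Rightarrow> 'a \<Rightarrow> 'a \<Rightarrow> 'a" where
  "inner_map G a x = inv\<^bsub>G\<^esub> a \<otimes>\<^bsub>G\<^esub> x \<otimes>\<^bsub>G\<^esub> a"

definition eq_maps_on :: "'a set \<Rightarrow> ('a \<Rightarrow> 'a) \<Rightarrow> ('a \<Rightarrow> 'a) \<Rightarrow> bool" where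
  "eq_maps_on Q g h \<longleftrightarrow> (\<forall>x\<in>Q. g x = h x)"

end

theory Submission
  imports Defs
begin

text \<open>
  A permutation is a symmetry of a quasigroup iff it preserves the set of triples
  \<open>(x, y, x \<cdot> y)\<close>, so the symmetries form a submonoid of \<open>S\<^sub>3\<close> and each symmetry is an identity
  in \<open>x\<close> and \<open>y\<close>. For the operation \<open>\<alpha> x + a + \<beta> y\<close> these identities are solved by inserting
  \<open>0\<close> and by using that \<open>\<alpha> x + a\<close> and \<open>a + \<beta> y\<close> each run through the whole group. For instance
  \<open>x \<cdot> (x \<cdot> y) = y\<close> becomes \<open>u + \<beta> (u + \<beta> y) = y\<close> for all \<open>u\<close> and \<open>y\<close>; hence \<open>\<beta> = -\<iota>\<close>, and
  inversion is then an endomorphism, which makes the group abelian. Likewise \<open>(x \<cdot> y) \<cdot> x = y\<close>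
  reduces to \<open>\<alpha> (u + \<beta> y) = y + \<alpha> u\<close>, so that \<open>\<beta> = \<alpha>\<^sup>-\<^sup>1\<close> and \<open>\<alpha>\<close> reverses sums.
\<close>

section \<open>Symmetries of a quasigroup\<close>

text \<open>The graph of \<open>f\<close>, encoded as in \<open>parastrophe\<close>: permutations
  act on it by precomposition, and only the values at 1, 2, 3 matter.\<close>

definition product_triples :: "'a set \<Rightarrow> ('a \<Rightarrow> 'a \<Rightarrow> 'a) \<Rightarrow> (nat \<Rightarrow> 'a) set" where
  "product_triples Q f = {x. x ` {1..3} \<subseteq> Q \<and> f (x 1) (x 2) = x 3}"

lemma atLeastAtMost_1_3: "{1..3::nat} = {1, 2, 3}"
  by auto

lemma product_triples_iff:
  "x \<in> product_triples Q f \<longleftrightarrow>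
     x 1 \<in> Q \<and> x 2 \<in> Q \<and> x 3 \<in> Q \<and> f (x 1) (x 2) = x 3"
  \<comment> \<open>The attribute \<open>simplified\<close> turns \<open>1\<close> into
    \<open>Suc 0\<close>, the form that the interval takes during simplification.\<close>
  by (auto simp: product_triples_def atLeastAtMost_1_3[simplified])

lemma product_triplesI:
  "x 1 \<in> Q \<Longrightarrow> x 2 \<in> Q \<Longrightarrow> x 3 \<in> Q \<Longrightarrow> f (x 1) (x 2) = x 3 \<Longrightarrow> x \<in> product_triples Q f"
  by (simp add: product_triples_iff)

lemma parastrophe_eq_THE:
  "parastrophe Q f \<sigma> u v =
     (THE w. \<exists>x\<in>product_triples Q f. x (\<sigma> 1) = u \<and> x (\<sigma> 2) = v \<and> x (\<sigma> 3) = w)"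
  unfolding parastrophe_def product_triples_def
  by (rule arg_cong[where f = The]) (rule ext, blast)

lemma quasigroup_left_cancel:
  assumes "quasigroup_on Q f" "a \<in> Q" "x \<in> Q" "y \<in> Q" "f a x = f a y"
  shows "x = y"
proof -
  have "f a y \<in> Q"
    using assms by (auto simp: quasigroup_on_def groupoid_on_def)
  then have "\<exists>!w. w \<in> Q \<and> f a w = f a y"
    using assms by (auto simp: quasigroup_on_def)
  then show ?thesis
    using assms by blast
qed

lemma quasigroup_right_cancel:
  assumes "quasigroup_on Q f" "a \<in> Q" "x \<in> Q" "y \<in> Q" "f x a = f y a"
  shows "x = y"
proof -
  have "f y a \<in> Q"
    using assms by (auto simp: quasigroup_on_def groupoid_on_def)
  then have "\<exists>!w. w \<in> Q \<and> f w a = f y a"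
    using assms by (auto simp: quasigroup_on_def)
  then show ?thesis
    using assms by blast
qed

text \<open>The quasigroup axiom made symmetric in the three positions: left cancellation, right
  cancellation and single-valuedness of \<open>f\<close> are the three cases. It yields uniqueness
  of the value described in \<open>parastrophe\<close>.\<close>

lemma product_triples_determined:
  assumes qg: "quasigroup_on Q f"
    and x: "x \<in> product_triples Q f" and y: "y \<in> product_triples Q f"
    and ij: "i \<in> {1..3}" "j \<in> {1..3}" "i \<noteq> j" "x i = y i" "x j = y j"
    and k: "k \<in> {1..3}"
  shows "x k = y k"
proof -
  have x': "x 1 \<in> Q" "x 2 \<in> Q" "f (x 1) (x 2) = x 3"
    and y': "y 1 \<in> Q" "y 2 \<in> Q" "f (y 1) (y 2) = y 3"
    using x y by (simp_all add: product_triples_iff)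
  have "x 1 = y 1 \<Longrightarrow> x 3 = y 3 \<Longrightarrow> x 2 = y 2"
    using quasigroup_left_cancel[OF qg x'(1) x'(2) y'(2)] x' y' by metis
  moreover have "x 2 = y 2 \<Longrightarrow> x 3 = y 3 \<Longrightarrow> x 1 = y 1"
    using quasigroup_right_cancel[OF qg x'(2) x'(1) y'(1)] x' y' by metis
  moreover have "x 1 = y 1 \<Longrightarrow> x 2 = y 2 \<Longrightarrow> x 3 = y 3"
    using x' y' by metis
  ultimately have "x 1 = y 1 \<and> x 2 = y 2 \<and> x 3 = y 3"
    using ij unfolding atLeastAtMost_1_3 by blast
  then show ?thesis
    using k unfolding atLeastAtMost_1_3 by blast
qed

text \<open>Supplies invariance under the inverse of a permutation of finite order, which is one of
  its powers.\<close>

lemma product_triples_funpow_closed: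
  assumes "\<And>x. x \<in> product_triples Q f \<Longrightarrow> x \<circ> \<sigma> \<in> product_triples Q f"
  shows "x \<in> product_triples Q f \<Longrightarrow> x \<circ> (\<sigma> ^^ n) \<in> product_triples Q f"
proof (induction n arbitrary: x)
  case (Suc n)
  then have "(x \<circ> \<sigma>) \<circ> (\<sigma> ^^ n) \<in> product_triples Q f"
    using assms by blast
  then show ?case by (simp only: comp_assoc funpow.simps)
qed simp

text \<open>The parastrophe sends \<open>x (\<sigma> 1)\<close>, \<open>x (\<sigma> 2)\<close> to
  \<open>x (\<sigma> 3)\<close> for each product triple \<open>x\<close>, so agreeing with
  \<open>f\<close> means that \<open>x \<circ> \<sigma>\<close> is again a product triple. One
  inclusion suffices because \<sigma> has finite order.\<close>

lemma mem_Sym_iff: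
  assumes qg: "quasigroup_on Q f"
  shows "\<sigma> \<in> Sym Q f \<longleftrightarrow> \<sigma> permutes {1..3} \<and>
    (\<forall>x\<in>product_triples Q f. x \<circ> \<sigma> \<in> product_triples Q f)"
proof
  assume \<sigma>: "\<sigma> \<in> Sym Q f"
  then have perm: "\<sigma> permutes {1..3}"
    by (simp add: Sym_def sym_group_carrier)
  have "x \<circ> \<sigma> \<in> product_triples Q f" if x: "x \<in> product_triples Q f" for x
  proof -
    have in13: "\<sigma> 1 \<in> {1..3}" "\<sigma> 2 \<in> {1..3}" "\<sigma> 3 \<in> {1..3}"
      using permutes_in_image[OF perm] by simp_all
    have xQ: "x (\<sigma> 1) \<in> Q" "x (\<sigma> 2) \<in> Q" "x (\<sigma> 3) \<in> Q"
      using in13 x by (auto simp: product_triples_def)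
    have "\<sigma> 1 \<noteq> \<sigma> 2"
      using permutes_inj[OF perm] by (simp add: inj_eq)
    then have "parastrophe Q f \<sigma> (x (\<sigma> 1)) (x (\<sigma> 2)) = x (\<sigma> 3)"
      unfolding parastrophe_eq_THE
      using x product_triples_determined[OF qg _ x in13(1,2) _ _ _ in13(3)]
      by (intro the_equality) blast+
    then show ?thesis
      using \<sigma> xQ by (intro product_triplesI) (auto simp: Sym_def)
  qed
  with perm show "\<sigma> permutes {1..3} \<and>
    (\<forall>x\<in>product_triples Q f. x \<circ> \<sigma> \<in> product_triples Q f)"
    by blast
next
  assume *: "\<sigma> permutes {1..3} \<and>
    (\<forall>x\<in>product_triples Q f. x \<circ> \<sigma> \<in> product_triples Q f)"
  then have perm: "\<sigma> permutes {1..3}" and closed: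
    "\<And>x. x \<in> product_triples Q f \<Longrightarrow> x \<circ> \<sigma> \<in> product_triples Q f"
    by blast+
  have "parastrophe Q f \<sigma> u v = f u v" if uv: "u \<in> Q" "v \<in> Q" for u v
  proof -
    define y where "y = (\<lambda>i::nat. if i = 1 then u else if i = 2 then v else f u v)"
    have y: "y \<in> product_triples Q f"
      using uv qg by (auto simp: product_triples_iff y_def quasigroup_on_def groupoid_on_def)
    have "permutation \<sigma>"
      using perm permutation_permutes by blast
    then obtain n where n: "\<sigma> ^^ n = id" "n > 0"
      using permutation_is_nilpotent by blast
    \<comment> \<open>The power \<open>\<sigma> ^^ (n - 1)\<close> is the inverse of \<sigma>, so
      \<open>x \<circ> \<sigma>\<close> is the triple \<open>y\<close> with entries
      \<open>u\<close>, \<open>v\<close>, \<open>f u v\<close>.\<close>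
    define x where "x = y \<circ> (\<sigma> ^^ (n - 1))"
    have x: "x \<in> product_triples Q f"
      unfolding x_def using closed y by (rule product_triples_funpow_closed)
    have "(\<sigma> ^^ (n - 1)) \<circ> \<sigma> = id"
      using n by (metis Suc_diff_1 funpow_Suc_right)
    then have x\<sigma>: "x (\<sigma> i) = y i" for i
      unfolding x_def by (metis comp_apply id_apply)
    show ?thesis
      unfolding parastrophe_eq_THE
    proof (rule the_equality)
      show "\<exists>x\<in>product_triples Q f. x (\<sigma> 1) = u \<and> x (\<sigma> 2) = v \<and> x (\<sigma> 3) = f u v"
        using x x\<sigma> by (intro bexI[of _ x]) (simp_all add: y_def)
    next
      fix w
      assume "\<exists>x\<in>product_triples Q f. x (\<sigma> 1) = u \<and> x (\<sigma> 2) = v \<and> x (\<sigma> 3) = w"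
      then obtain x where "x \<in> product_triples Q f" "x (\<sigma> 1) = u" "x (\<sigma> 2) = v" "x (\<sigma> 3) = w"
        by blast
      \<comment> \<open>Membership of \<open>x \<circ> \<sigma>\<close> in the graph says exactly
        \<open>f u v = w\<close>.\<close>
      then show "w = f u v"
        using closed[of x] by (simp add: product_triples_iff)
    qed
  qed
  then show "\<sigma> \<in> Sym Q f"
    using perm by (simp add: Sym_def sym_group_carrier)
qed

lemma Sym_id:
  assumes "quasigroup_on Q f"
  shows "id \<in> Sym Q f"
  using assms by (simp add: mem_Sym_iff permutes_id)

lemma Sym_comp:
  assumes "quasigroup_on Q f" "\<sigma> \<in> Sym Q f" "\<tau> \<in> Sym Q f"
  shows "\<sigma> \<circ> \<tau> \<in> Sym Q f"
  using assms by (simp add: mem_Sym_iff permutes_compose flip: comp_assoc)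

text \<open>Invariance need only be tested on the triples with entries \<open>u\<close>,
  \<open>v\<close>, \<open>f u v\<close>, since the first two entries of a product triple fix the
  third. Evaluating \<sigma> at 1, 2, 3 then yields the identity that belongs to \<sigma>.\<close>

lemma Sym_iff_identity:
  assumes qg: "quasigroup_on Q f" and perm: "\<sigma> permutes {1..3}"
  shows "\<sigma> \<in> Sym Q f \<longleftrightarrow> (\<forall>u\<in>Q. \<forall>v\<in>Q.
    let x = (\<lambda>i::nat. if i = 1 then u else if i = 2 then v else f u v)
    in f (x (\<sigma> 1)) (x (\<sigma> 2)) = x (\<sigma> 3))"
    (is "_ \<longleftrightarrow> (\<forall>u\<in>Q. \<forall>v\<in>Q. ?P u v)")
proof
  assume \<sigma>: "\<sigma> \<in> Sym Q f"
  show "\<forall>u\<in>Q. \<forall>v\<in>Q. ?P u v"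
  proof (intro ballI)
    fix u v assume uv: "u \<in> Q" "v \<in> Q"
    define x where "x = (\<lambda>i::nat. if i = 1 then u else if i = 2 then v else f u v)"
    have "x \<in> product_triples Q f"
      using uv qg by (auto simp: product_triples_iff x_def quasigroup_on_def groupoid_on_def)
    then have "x \<circ> \<sigma> \<in> product_triples Q f"
      using \<sigma> by (simp add: mem_Sym_iff[OF qg])
    then have "f (x (\<sigma> 1)) (x (\<sigma> 2)) = x (\<sigma> 3)"
      by (simp add: product_triples_iff)
    then show "?P u v"
      unfolding x_def Let_def .
  qed
next
  assume *: "\<forall>u\<in>Q. \<forall>v\<in>Q. ?P u v"
  have "x \<circ> \<sigma> \<in> product_triples Q f" if x: "x \<in> product_triples Q f" for x
  proof -
    have in13: "\<sigma> 1 \<in> {1..3}" "\<sigma> 2 \<in> {1..3}" "\<sigma> 3 \<in> {1..3}"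
      using permutes_in_image[OF perm] by simp_all
    have xQ: "x (\<sigma> 1) \<in> Q" "x (\<sigma> 2) \<in> Q" "x (\<sigma> 3) \<in> Q" "x 1 \<in> Q" "x 2 \<in> Q"
      using in13 x by (auto simp: product_triples_def)
    have eq: "(if i = 1 then x 1 else if i = 2 then x 2 else f (x 1) (x 2)) = x i"
      if "i \<in> {1..3}" for i
      using that x by (auto simp: product_triples_iff atLeastAtMost_1_3[simplified])
    from * xQ have "?P (x 1) (x 2)"
      by blast
    then have "f (x (\<sigma> 1)) (x (\<sigma> 2)) = x (\<sigma> 3)"
      unfolding Let_def eq[OF in13(1)] eq[OF in13(2)] eq[OF in13(3)] .
    then show ?thesis
      using xQ by (simp add: product_triples_iff)
  qed
  then show "\<sigma> \<in> Sym Q f"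
    using perm by (simp add: mem_Sym_iff[OF qg])
qed

section \<open>The elements of S_3 and A_3\<close>

definition cycle3 :: "nat \<Rightarrow> nat" where
  "cycle3 = transpose 1 2 \<circ> transpose 2 3"

lemma transpose_permutes_1_3:
  "transpose 1 2 permutes {1..3::nat}" "transpose 2 3 permutes {1..3::nat}"
  "transpose 1 3 permutes {1..3::nat}"
  by (auto intro: permutes_swap_id)

lemma cycle3_permutes: "cycle3 permutes {1..3}"
  unfolding cycle3_def by (intro permutes_compose transpose_permutes_1_3)

lemma cycle3_simps: "cycle3 1 = 2" "cycle3 2 = 3" "cycle3 3 = 1"
  by (simp_all add: cycle3_def transpose_def)

lemma permutes_eqI:
  assumes "\<sigma> permutes S" "\<tau> permutes S" "\<And>i. i \<in> S \<Longrightarrow> \<sigma> i = \<tau> i"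
  shows "\<sigma> = \<tau>"
  using assms by (metis ext permutes_not_in)

lemma permutes_1_3_cases:
  assumes "\<sigma> permutes {1..3}"
  shows "\<sigma> \<in> {id, transpose 1 2, transpose 2 3, transpose 1 3, cycle3, cycle3 \<circ> cycle3}"
proof -
  have in13: "\<sigma> 1 \<in> {1,2,3}" "\<sigma> 2 \<in> {1,2,3}" "\<sigma> 3 \<in> {1,2,3}"
    using permutes_in_image[OF assms] unfolding atLeastAtMost_1_3 by blast+
  have "\<sigma> 1 \<noteq> \<sigma> 2" "\<sigma> 1 \<noteq> \<sigma> 3" "\<sigma> 2 \<noteq> \<sigma> 3"
    using permutes_inj[OF assms] by (simp_all add: inj_eq)
  with in13 consider
    "\<sigma> 1 = 1" "\<sigma> 2 = 2" "\<sigma> 3 = 3" | "\<sigma> 1 = 2" "\<sigma> 2 = 1" "\<sigma> 3 = 3"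
    | "\<sigma> 1 = 1" "\<sigma> 2 = 3" "\<sigma> 3 = 2" | "\<sigma> 1 = 3" "\<sigma> 2 = 2" "\<sigma> 3 = 1"
    | "\<sigma> 1 = 2" "\<sigma> 2 = 3" "\<sigma> 3 = 1" | "\<sigma> 1 = 3" "\<sigma> 2 = 1" "\<sigma> 3 = 2"
    by (elim insertE emptyE) simp_all
  moreover have eqI: "\<sigma> = \<tau>"
    if "\<tau> permutes {1..3}" "\<sigma> 1 = \<tau> 1" "\<sigma> 2 = \<tau> 2" "\<sigma> 3 = \<tau> 3" for \<tau>
    using assms that(1) by (rule permutes_eqI) (use that in \<open>auto simp: atLeastAtMost_1_3[simplified]\<close>)
  ultimately show ?thesis
  proof cases
    case 1 then have "\<sigma> = id" by (intro eqI permutes_id) simp_all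
    then show ?thesis by simp
  next
    case 2 then have "\<sigma> = transpose 1 2"
      by (intro eqI transpose_permutes_1_3) (simp_all add: transpose_def)
    then show ?thesis by simp
  next
    case 3 then have "\<sigma> = transpose 2 3"
      by (intro eqI transpose_permutes_1_3) (simp_all add: transpose_def)
    then show ?thesis by simp
  next
    case 4 then have "\<sigma> = transpose 1 3"
      by (intro eqI transpose_permutes_1_3) (simp_all add: transpose_def)
    then show ?thesis by simp
  next
    case 5 then have "\<sigma> = cycle3"
      by (intro eqI cycle3_permutes) (simp_all only: cycle3_simps)
    then show ?thesis by simp
  next
    case 6 then have "\<sigma> = cycle3 \<circ> cycle3"
      by (intro eqI permutes_compose cycle3_permutes) (simp_all only: cycle3_simps comp_apply)
    then show ?thesis by simp
  qed
qed

lemma evenperm_transpose_nat: "a \<noteq> b \<Longrightarrow> \<not> evenperm (transpose a (b::nat))"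
  by (simp add: evenperm_swap)

text \<open>Parity removes the three transpositions from the list of six permutations;
  \<open>cycle3\<close> is even as a product of two transpositions.\<close>

lemma carrier_alt_group_3: "carrier (alt_group 3) = {id, cycle3, cycle3 \<circ> cycle3}"
proof -
  have even: "evenperm cycle3"
    unfolding cycle3_def
    by (subst evenperm_comp) (auto simp: evenperm_swap permutation_swap_id)
  have perm: "permutation cycle3"
    using cycle3_permutes permutation_permutes by blast
  have even2: "evenperm (cycle3 \<circ> cycle3)"
    using even perm by (simp add: evenperm_comp)
  show ?thesis
  proof (intro equalityI subsetI)
    fix \<sigma> assume "\<sigma> \<in> carrier (alt_group 3)"
    then have "\<sigma> permutes {1..3}" "evenperm \<sigma>"
      by (simp_all add: alt_group_carrier)
    then show "\<sigma> \<in> {id, cycle3, cycle3 \<circ> cycle3}"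
      using permutes_1_3_cases evenperm_transpose_nat[of 1 2]
        evenperm_transpose_nat[of 2 3] evenperm_transpose_nat[of 1 3]
      by fastforce
  next
    fix \<sigma> assume "\<sigma> \<in> {id, cycle3, cycle3 \<circ> cycle3}"
    then have "\<sigma> permutes {1..3}" "evenperm \<sigma>"
      using even even2 cycle3_permutes permutes_compose[OF cycle3_permutes cycle3_permutes]
      by (elim insertE emptyE; simp add: permutes_id evenperm_id)+
    then show "\<sigma> \<in> carrier (alt_group 3)"
      by (simp add: alt_group_carrier)
  qed
qed

section \<open>The symmetry classes as identities\<close>

lemma commutative_iff:
  assumes "quasigroup_on Q f"
  shows "commutative Q f \<longleftrightarrow> (\<forall>x\<in>Q. \<forall>y\<in>Q. f x y = f y x)"
  using assms unfolding commutative_def Sym_iff_identity[OF assms transpose_permutes_1_3(1)]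
  by (auto simp: transpose_def)

lemma left_symmetric_iff:
  assumes "quasigroup_on Q f"
  shows "left_symmetric Q f \<longleftrightarrow> (\<forall>x\<in>Q. \<forall>y\<in>Q. f x (f x y) = y)"
  using assms unfolding left_symmetric_def Sym_iff_identity[OF assms transpose_permutes_1_3(2)]
  by (auto simp: transpose_def)

lemma right_symmetric_iff:
  assumes "quasigroup_on Q f"
  shows "right_symmetric Q f \<longleftrightarrow> (\<forall>x\<in>Q. \<forall>y\<in>Q. f (f x y) y = x)"
  using assms unfolding right_symmetric_def Sym_iff_identity[OF assms transpose_permutes_1_3(3)]
  by (auto simp: transpose_def)

text \<open>\<open>cycle3\<close> generates A_3, and \<open>Sym Q f\<close> is closed under
  composition.\<close>

lemma cycle3_mem_Sym_iff:
  assumes "quasigroup_on Q f"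
  shows "cycle3 \<in> Sym Q f \<longleftrightarrow> semi_symmetric Q f"
  using assms Sym_id[OF assms] Sym_comp[OF assms]
  by (auto simp: semi_symmetric_def carrier_alt_group_3)

text \<open>Since \<open>cycle3\<close> has order 3, its square generates A_3 as well; this form
  recovers \<open>cycle3\<close> from the square by composition alone.\<close>

lemma cycle3_power_4: "(cycle3 \<circ> cycle3) \<circ> (cycle3 \<circ> cycle3) = cycle3"
proof (rule permutes_eqI)
  show "(cycle3 \<circ> cycle3) \<circ> (cycle3 \<circ> cycle3) permutes {1..3}"
    by (intro permutes_compose cycle3_permutes)
  show "((cycle3 \<circ> cycle3) \<circ> (cycle3 \<circ> cycle3)) i = cycle3 i" if "i \<in> {1..3}" for i
    using that unfolding atLeastAtMost_1_3 by (elim insertE emptyE) (simp_all only: comp_apply cycle3_simps)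
qed (rule cycle3_permutes)

lemma cycle3_square_mem_Sym_iff:
  assumes "quasigroup_on Q f"
  shows "cycle3 \<circ> cycle3 \<in> Sym Q f \<longleftrightarrow> semi_symmetric Q f"
  using Sym_comp[OF assms] cycle3_power_4 unfolding cycle3_mem_Sym_iff[OF assms, symmetric]
  by metis

text \<open>The square of \<open>cycle3\<close> gives the identity in this form;
  \<open>cycle3\<close> itself would give the mirror image \<open>f y (f x y) = x\<close>.\<close>

lemma semi_symmetric_iff:
  assumes "quasigroup_on Q f"
  shows "semi_symmetric Q f \<longleftrightarrow> (\<forall>x\<in>Q. \<forall>y\<in>Q. f (f x y) x = y)"
  unfolding cycle3_square_mem_Sym_iff[OF assms, symmetric]
    Sym_iff_identity[OF assms permutes_compose[OF cycle3_permutes cycle3_permutes]]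
    comp_apply cycle3_simps
  by auto

text \<open>The transpositions (12) and (23) generate S_3.\<close>

lemma totally_symmetric_iff:
  assumes "quasigroup_on Q f"
  shows "totally_symmetric Q f \<longleftrightarrow> commutative Q f \<and> left_symmetric Q f"
proof
  assume "totally_symmetric Q f"
  then show "commutative Q f \<and> left_symmetric Q f"
    using transpose_permutes_1_3
    by (simp add: totally_symmetric_def commutative_def left_symmetric_def sym_group_carrier)
next
  assume *: "commutative Q f \<and> left_symmetric Q f"
  then have sr: "transpose 1 2 \<in> Sym Q f" "transpose 2 3 \<in> Sym Q f"
    by (simp_all add: commutative_def left_symmetric_def)
  \<comment> \<open>\<open>cycle3\<close> was defined as the product of these two
    transpositions.\<close>
  then have c: "cycle3 \<in> Sym Q f"
    unfolding cycle3_def by (rule Sym_comp[OF assms])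
  \<comment> \<open>Commutativity gives \<open>f (f x y) y = f y (f y x)\<close>, which left
    symmetry reduces to \<open>x\<close>.\<close>
  have "right_symmetric Q f"
    using * assms by (simp add: commutative_iff left_symmetric_iff right_symmetric_iff)
      (metis groupoid_on_def quasigroup_on_def)
  then have "transpose 1 3 \<in> Sym Q f"
    by (simp add: right_symmetric_def)
  then have "\<sigma> \<in> Sym Q f" if "\<sigma> permutes {1..3}" for \<sigma>
    using permutes_1_3_cases[OF that] sr c Sym_id[OF assms] Sym_comp[OF assms c c] by blast
  then show "totally_symmetric Q f"
    using assms by (auto simp: totally_symmetric_def sym_group_carrier Sym_def)
qed

text \<open>Each of the five nonidentity permutations witnesses one of the four classes; both
  3-cycles witness semi-symmetry.\<close>

lemma asymmetric_iff:
  assumes "quasigroup_on Q f"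
  shows "asymmetric Q f \<longleftrightarrow> \<not> commutative Q f \<and> \<not> left_symmetric Q f \<and>
    \<not> right_symmetric Q f \<and> \<not> semi_symmetric Q f"
proof -
  have "transpose 1 2 \<noteq> (id :: nat \<Rightarrow> nat)" "transpose 2 3 \<noteq> (id :: nat \<Rightarrow> nat)"
    "transpose 1 3 \<noteq> (id :: nat \<Rightarrow> nat)"
    by (simp_all add: transpose_eq_id_iff)
  moreover have "cycle3 \<noteq> id"
    using cycle3_simps(1) by auto
  moreover have "\<sigma> \<in> {id, transpose 1 2, transpose 2 3, transpose 1 3, cycle3, cycle3 \<circ> cycle3}"
    if "\<sigma> \<in> Sym Q f" for \<sigma>
    using permutes_1_3_cases that mem_Sym_iff[OF assms] by blast
  ultimately show ?thesis
    using assms Sym_id[OF assms] cycle3_mem_Sym_iff[OF assms] cycle3_square_mem_Sym_iff[OF assms]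
    unfolding asymmetric_def commutative_def left_symmetric_def right_symmetric_def
    by (smt (verit, ccfv_threshold) insert_iff singleton_iff subsetI subset_singletonD empty_iff)
qed

section \<open>Canonical decompositions\<close>

lemma (in group) inv_cancel_left:
  assumes "x \<in> carrier G" "y \<in> carrier G"
  shows "inv x \<otimes> (x \<otimes> y) = y" "x \<otimes> (inv x \<otimes> y) = y"
  using assms by (simp_all flip: m_assoc)

text \<open>Inversion always reverses products. If it also preserves them, then inverting -y - x
  gives both x + y and y + x.\<close>

lemma (in group) comm_group_if_inv_mult:
  assumes "\<And>x y. x \<in> carrier G \<Longrightarrow> y \<in> carrier G \<Longrightarrow> inv (x \<otimes> y) = inv x \<otimes> inv y"
  shows "comm_group G"
proof (rule group_comm_groupI)
  fix x y assume "x \<in> carrier G" "y \<in> carrier G"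
  then show "x \<otimes> y = y \<otimes> x"
    using assms[of "inv y" "inv x"] by (simp add: inv_mult_group)
qed

text \<open>Makes the inverse of I_a explicit, so that the condition on the cube of \<alpha> becomes
  an equation in the group.\<close>

lemma inv_into_inner_map:
  fixes G (structure)
  assumes "group G" and a: "a \<in> carrier G" and x: "x \<in> carrier G"
  shows "inv_into (carrier G) (inner_map G a) x = a \<otimes> x \<otimes> inv a"
proof (rule inv_into_f_eq)
  interpret group G by fact
  show "inj_on (inner_map G a) (carrier G)"
    using a by (intro inj_onI) (simp add: inner_map_def)
  show "a \<otimes> x \<otimes> inv a \<in> carrier G"
    using a x by simp
  show "inner_map G a (a \<otimes> x \<otimes> inv a) = x"
    using a x by (simp add: inner_map_def m_assoc inv_cancel_left)
qed

text \<open>A canonical decomposition with \<open>carrier G\<close> and the unit in place of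
  \<open>Q\<close> and \<open>z\<close>, which makes the group the context of the
  calculations.\<close>

locale isotope_decomposition = group G for G :: "'a monoid" (structure) +
  fixes f :: "'a \<Rightarrow> 'a \<Rightarrow> 'a" and \<alpha> \<beta> :: "'a \<Rightarrow> 'a" and a :: 'a
  assumes a_closed [simp]: "a \<in> carrier G"
    and bij_\<alpha>: "bij_betw \<alpha> (carrier G) (carrier G)"
    and bij_\<beta>: "bij_betw \<beta> (carrier G) (carrier G)"
    and \<alpha>_one [simp]: "\<alpha> \<one> = \<one>" and \<beta>_one [simp]: "\<beta> \<one> = \<one>"
    and f_eq: "\<And>x y. x \<in> carrier G \<Longrightarrow> y \<in> carrier G \<Longrightarrow> f x y = \<alpha> x \<otimes> a \<otimes> \<beta> y"
begin

lemma \<alpha>_closed [simp]: "x \<in> carrier G \<Longrightarrow> \<alpha> x \<in> carrier G"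
  using bij_\<alpha> by (rule bij_betwE[rule_format])

lemma \<beta>_closed [simp]: "x \<in> carrier G \<Longrightarrow> \<beta> x \<in> carrier G"
  using bij_\<beta> by (rule bij_betwE[rule_format])

lemma \<alpha>_eq_iff: "x \<in> carrier G \<Longrightarrow> y \<in> carrier G \<Longrightarrow> \<alpha> x = \<alpha> y \<longleftrightarrow> x = y"
  using bij_\<alpha> by (auto simp: bij_betw_def inj_on_def)

lemma \<beta>_eq_iff: "x \<in> carrier G \<Longrightarrow> y \<in> carrier G \<Longrightarrow> \<beta> x = \<beta> y \<longleftrightarrow> x = y"
  using bij_\<beta> by (auto simp: bij_betw_def inj_on_def)

lemma \<alpha>_surj:
  assumes "y \<in> carrier G"
  obtains x where "x \<in> carrier G" "\<alpha> x = y"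
  using assms bij_\<alpha> unfolding bij_betw_def by (metis imageE)

lemma \<beta>_surj:
  assumes "y \<in> carrier G"
  obtains x where "x \<in> carrier G" "\<beta> x = y"
  using assms bij_\<beta> unfolding bij_betw_def by (metis imageE)

text \<open>Where \<open>x\<close> enters an identity only through \<alpha> x + a, that sum can be
  replaced by a free variable, and the free member disappears.\<close>

lemma translate_\<alpha>_surj:
  assumes "u \<in> carrier G"
  obtains x where "x \<in> carrier G" "\<alpha> x \<otimes> a = u"
  using \<alpha>_surj[of "u \<otimes> inv a"] assms by (metis a_closed inv_closed inv_solve_right m_closed)

lemma translate_\<beta>_surj:
  assumes "u \<in> carrier G"
  obtains x where "x \<in> carrier G" "a \<otimes> \<beta> x = u"
  using \<beta>_surj[of "inv a \<otimes> u"] assms by (metis a_closed inv_closed inv_solve_left m_closed)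

lemma quasigroup: "quasigroup_on (carrier G) f"
proof -
  have ex_left: "\<exists>!x. x \<in> carrier G \<and> f x c = b" if "c \<in> carrier G" "b \<in> carrier G" for b c
  proof -
    have "b \<otimes> inv (a \<otimes> \<beta> c) \<in> carrier G"
      using that by simp
    then obtain x where "x \<in> carrier G" "\<alpha> x = b \<otimes> inv (a \<otimes> \<beta> c)"
      by (rule \<alpha>_surj)
    then have "x \<in> carrier G \<and> f x c = b"
      using that by (simp add: f_eq inv_mult_group m_assoc inv_cancel_left)
    moreover have "y = x" if "y \<in> carrier G" "x \<in> carrier G" "f x c = b" "f y c = b" for x y
      using that \<open>c \<in> carrier G\<close> by (auto simp: f_eq \<alpha>_eq_iff)
    ultimately show ?thesis by blast
  qed
  have ex_right: "\<exists>!y. y \<in> carrier G \<and> f c y = b" if "c \<in> carrier G" "b \<in> carrier G" for b c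
  proof -
    have "inv (\<alpha> c \<otimes> a) \<otimes> b \<in> carrier G"
      using that by simp
    then obtain y where "y \<in> carrier G" "\<beta> y = inv (\<alpha> c \<otimes> a) \<otimes> b"
      by (rule \<beta>_surj)
    then have "y \<in> carrier G \<and> f c y = b"
      using that by (simp add: f_eq inv_mult_group m_assoc inv_cancel_left)
    moreover have "y = x" if "y \<in> carrier G" "x \<in> carrier G" "f c x = b" "f c y = b" for x y
      using that \<open>c \<in> carrier G\<close> by (auto simp: f_eq \<beta>_eq_iff)
    ultimately show ?thesis by blast
  qed
  show ?thesis
    unfolding quasigroup_on_def groupoid_on_def using ex_left ex_right by (auto simp: f_eq)
qed

section \<open>Solving the identities for the coefficients\<close>

lemma commutative_isotope_iff:
  "commutative (carrier G) f \<longleftrightarrow> comm_group G \<and> eq_maps_on (carrier G) \<beta> \<alpha>"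
  unfolding commutative_iff[OF quasigroup]
proof
  assume comm: "\<forall>x\<in>carrier G. \<forall>y\<in>carrier G. f x y = f y x"
  have \<alpha>a: "\<alpha> x \<otimes> a = a \<otimes> \<beta> x" if "x \<in> carrier G" for x
    using comm[rule_format, of x \<one>] that by (simp add: f_eq)
  have "comm_group G"
  proof (rule group_comm_groupI)
    fix u v assume uv: "u \<in> carrier G" "v \<in> carrier G"
    then obtain x y where xy: "x \<in> carrier G" "y \<in> carrier G" "\<alpha> x = u" "\<alpha> y = v"
      using \<alpha>_surj by metis
    \<comment> \<open>Moving \<open>a\<close> to the right by \<open>\<alpha>a\<close> turns
      \<open>f x y\<close> into \<alpha> x + \<alpha> y + a, and \<open>f y x\<close>
      likewise.\<close>
    then have "u \<otimes> v \<otimes> a = v \<otimes> u \<otimes> a"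
      using comm[rule_format, of x y] \<alpha>a[of x] \<alpha>a[of y] uv by (simp add: f_eq m_assoc)
    then show "u \<otimes> v = v \<otimes> u"
      using uv by simp
  qed
  moreover from this interpret comm_group G .
  have "eq_maps_on (carrier G) \<beta> \<alpha>"
    using \<alpha>a by (auto simp: eq_maps_on_def m_comm[of _ a])
  ultimately show "comm_group G \<and> eq_maps_on (carrier G) \<beta> \<alpha>" ..
next
  assume *: "comm_group G \<and> eq_maps_on (carrier G) \<beta> \<alpha>"
  then interpret comm_group G by blast
  show "\<forall>x\<in>carrier G. \<forall>y\<in>carrier G. f x y = f y x"
    using * by (auto simp: f_eq eq_maps_on_def m_ac)
qed

lemma left_symmetric_isotope_iff:
  "left_symmetric (carrier G) f \<longleftrightarrow> comm_group G \<and> eq_maps_on (carrier G) \<beta> (\<lambda>x. inv x)"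
  unfolding left_symmetric_iff[OF quasigroup]
proof
  assume *: "\<forall>x\<in>carrier G. \<forall>y\<in>carrier G. f x (f x y) = y"
  have eq: "u \<otimes> \<beta> (u \<otimes> \<beta> y) = y" if "u \<in> carrier G" "y \<in> carrier G" for u y
  proof -
    obtain x where x: "x \<in> carrier G" "\<alpha> x \<otimes> a = u"
      using \<open>u \<in> carrier G\<close> by (rule translate_\<alpha>_surj)
    then show ?thesis
      using *[rule_format, of x y] that by (simp add: f_eq)
  qed
  have \<beta>: "\<beta> u = inv u" if "u \<in> carrier G" for u
  proof -
    \<comment> \<open>At y = 0 the identity says u + \<beta> u = 0. As \<open>inv_equality\<close>
      expects a left inverse, \<open>u\<close> comes out as the inverse of
      \<open>\<beta> u\<close>.\<close>
    have "inv (\<beta> u) = u"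
      using eq[of u \<one>] that by (intro inv_equality) simp_all
    then show ?thesis
      using that by (metis \<beta>_closed inv_inv)
  qed
  have "comm_group G"
  proof (rule comm_group_if_inv_mult)
    fix u v assume uv: "u \<in> carrier G" "v \<in> carrier G"
    then have "u \<otimes> inv (u \<otimes> v) = inv v"
      using eq[of u "inv v"] by (simp add: \<beta>)
    then show "inv (u \<otimes> v) = inv u \<otimes> inv v"
      using uv by (simp add: inv_solve_left)
  qed
  then show "comm_group G \<and> eq_maps_on (carrier G) \<beta> (\<lambda>x. inv x)"
    using \<beta> by (simp add: eq_maps_on_def)
next
  assume *: "comm_group G \<and> eq_maps_on (carrier G) \<beta> (\<lambda>x. inv x)"
  then interpret comm_group G by blast
  show "\<forall>x\<in>carrier G. \<forall>y\<in>carrier G. f x (f x y) = y"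
    using * by (auto simp: f_eq eq_maps_on_def inv_mult m_assoc inv_cancel_left m_lcomm[of a])
qed

text \<open>Mirror image of the left symmetric case: here \<open>y\<close> enters only through a +
  \<beta> y, which becomes the free variable.\<close>

lemma right_symmetric_isotope_iff:
  "right_symmetric (carrier G) f \<longleftrightarrow> comm_group G \<and> eq_maps_on (carrier G) \<alpha> (\<lambda>x. inv x)"
  unfolding right_symmetric_iff[OF quasigroup]
proof
  assume *: "\<forall>x\<in>carrier G. \<forall>y\<in>carrier G. f (f x y) y = x"
  have eq: "\<alpha> (\<alpha> x \<otimes> u) \<otimes> u = x" if "u \<in> carrier G" "x \<in> carrier G" for u x
  proof -
    obtain y where y: "y \<in> carrier G" "a \<otimes> \<beta> y = u"
      using \<open>u \<in> carrier G\<close> by (rule translate_\<beta>_surj)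
    then show ?thesis
      using *[rule_format, of x y] that by (simp add: f_eq m_assoc)
  qed
  have \<alpha>: "\<alpha> u = inv u" if "u \<in> carrier G" for u
    using eq[of u \<one>] that by (simp add: inv_equality)
  have "comm_group G"
  proof (rule comm_group_if_inv_mult)
    fix u v assume uv: "u \<in> carrier G" "v \<in> carrier G"
    then have "inv (u \<otimes> v) \<otimes> v = inv u"
      using eq[of v "inv u"] by (simp add: \<alpha>)
    then show "inv (u \<otimes> v) = inv u \<otimes> inv v"
      using uv by (simp add: inv_solve_right)
  qed
  then show "comm_group G \<and> eq_maps_on (carrier G) \<alpha> (\<lambda>x. inv x)"
    using \<alpha> by (simp add: eq_maps_on_def)
next
  assume *: "comm_group G \<and> eq_maps_on (carrier G) \<alpha> (\<lambda>x. inv x)"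
  then interpret comm_group G by blast
  \<comment> \<open>The variable \<open>v\<close> stands for \<open>\<beta> y\<close>.\<close>
  have "inv (inv x \<otimes> a \<otimes> v) \<otimes> a \<otimes> v = x" if "x \<in> carrier G" "v \<in> carrier G" for x v
    using that by (simp add: inv_mult m_assoc m_lcomm[of _ a] inv_cancel_left)
      (simp add: m_lcomm inv_cancel_left)
  then show "\<forall>x\<in>carrier G. \<forall>y\<in>carrier G. f (f x y) y = x"
    using * by (auto simp: f_eq eq_maps_on_def)
qed

lemma semi_symmetric_isotope_iff:
  "semi_symmetric (carrier G) f \<longleftrightarrow>
     anti_automorphism G \<alpha> \<and> eq_maps_on (carrier G) \<beta> (inv_into (carrier G) \<alpha>) \<and>
     eq_maps_on (carrier G) (\<alpha> ^^ 3) (\<lambda>x. inv (inv_into (carrier G) (inner_map G a) x)) \<and>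
     \<alpha> a = inv a"
  unfolding semi_symmetric_iff[OF quasigroup]
proof
  assume *: "\<forall>x\<in>carrier G. \<forall>y\<in>carrier G. f (f x y) x = y"
  have eq: "\<alpha> (\<alpha> x \<otimes> a \<otimes> \<beta> y) \<otimes> (a \<otimes> \<beta> x) = y"
    if "x \<in> carrier G" "y \<in> carrier G" for x y
    using *[rule_format, OF that] that by (simp add: f_eq m_assoc)
  have \<alpha>\<beta>_mult: "\<alpha> (u \<otimes> \<beta> y) = y \<otimes> \<alpha> u" if u: "u \<in> carrier G" and y: "y \<in> carrier G" for u y
  proof -
    obtain x where x: "x \<in> carrier G" "\<alpha> x \<otimes> a = u"
      using u by (rule translate_\<alpha>_surj)
    \<comment> \<open>The case y = 0 identifies the tail a + \<beta> x as -\<alpha> u, which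
      eliminates \<open>a\<close> and leaves \<alpha> (u + \<beta> y) - \<alpha> u = y.\<close>
    have "inv (a \<otimes> \<beta> x) = \<alpha> u"
      using eq[of x \<one>] x u by (intro inv_equality) simp_all
    then have "inv (\<alpha> u) = a \<otimes> \<beta> x"
      using x by (metis \<beta>_closed a_closed inv_inv m_closed)
    then have "\<alpha> (u \<otimes> \<beta> y) \<otimes> inv (\<alpha> u) = y"
      using eq[of x y] x y by simp
    then show ?thesis
      using u y by (metis \<alpha>_closed \<beta>_closed inv_closed inv_solve_right m_closed inv_inv)
  qed
  have \<alpha>\<beta>: "\<alpha> (\<beta> y) = y" if "y \<in> carrier G" for y
    using \<alpha>\<beta>_mult[of \<one> y] that by simp
  have anti: "\<alpha> (u \<otimes> v) = \<alpha> v \<otimes> \<alpha> u" if "u \<in> carrier G" "v \<in> carrier G" for u v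
  proof -
    obtain y where y: "y \<in> carrier G" "\<beta> y = v"
      using \<open>v \<in> carrier G\<close> by (rule \<beta>_surj)
    then show ?thesis
      using \<alpha>\<beta>_mult[of u y] \<alpha>\<beta>[of y] that by simp
  qed
  have \<beta>\<alpha>: "\<beta> (\<alpha> x) = x" if "x \<in> carrier G" for x
    using \<alpha>\<beta>[of "\<alpha> x"] that by (simp add: \<alpha>_eq_iff)
  have \<alpha>a: "\<alpha> a = inv a"
    using eq[of \<one> \<one>] by (simp add: inv_equality)
  have "\<alpha> (\<alpha> (\<alpha> x)) = inv (a \<otimes> x \<otimes> inv a)" if "x \<in> carrier G" for x
  proof -
    \<comment> \<open>The identity at \<alpha> x and 0, with the outer \<alpha> distributed in
      reverse order and \<open>\<beta> (\<alpha> x)\<close> cancelled to \<open>x\<close>.\<close>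
    have "inv a \<otimes> \<alpha> (\<alpha> (\<alpha> x)) \<otimes> (a \<otimes> x) = \<one>"
      using eq[of "\<alpha> x" \<one>] that by (simp add: anti \<alpha>a \<beta>\<alpha>)
    then have "inv (a \<otimes> x) = inv a \<otimes> \<alpha> (\<alpha> (\<alpha> x))"
      using that by (intro inv_equality) auto
    then have "\<alpha> (\<alpha> (\<alpha> x)) = a \<otimes> inv (a \<otimes> x)"
      using that by (simp add: inv_cancel_left)
    then show ?thesis
      using that by (simp add: inv_mult_group m_assoc)
  qed
  then show "anti_automorphism G \<alpha> \<and> eq_maps_on (carrier G) \<beta> (inv_into (carrier G) \<alpha>) \<and>
     eq_maps_on (carrier G) (\<alpha> ^^ 3) (\<lambda>x. inv (inv_into (carrier G) (inner_map G a) x)) \<and>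
     \<alpha> a = inv a"
    using anti \<alpha>a \<alpha>\<beta> bij_\<alpha>
    by (auto simp: anti_automorphism_def eq_maps_on_def inv_into_inner_map[OF is_group] numeral_3_eq_3
        bij_betw_def intro!: inv_into_f_eq[symmetric])
next
  assume *: "anti_automorphism G \<alpha> \<and> eq_maps_on (carrier G) \<beta> (inv_into (carrier G) \<alpha>) \<and>
     eq_maps_on (carrier G) (\<alpha> ^^ 3) (\<lambda>x. inv (inv_into (carrier G) (inner_map G a) x)) \<and>
     \<alpha> a = inv a"
  then have anti: "\<And>u v. u \<in> carrier G \<Longrightarrow> v \<in> carrier G \<Longrightarrow> \<alpha> (u \<otimes> v) = \<alpha> v \<otimes> \<alpha> u"
    and \<alpha>a: "\<alpha> a = inv a"
    by (simp_all add: anti_automorphism_def)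
  have \<alpha>\<beta>: "\<alpha> (\<beta> y) = y" if "y \<in> carrier G" for y
    using * that bij_\<alpha> by (simp add: eq_maps_on_def bij_betw_def f_inv_into_f)
  have cube: "\<alpha> (\<alpha> (\<alpha> x)) = inv (a \<otimes> x \<otimes> inv a)" if "x \<in> carrier G" for x
    using * that by (simp add: eq_maps_on_def inv_into_inner_map[OF is_group] numeral_3_eq_3)
  show "\<forall>x\<in>carrier G. \<forall>y\<in>carrier G. f (f x y) x = y"
  proof (intro ballI)
    fix x y assume xy: "x \<in> carrier G" "y \<in> carrier G"
    \<comment> \<open>Distributing \<alpha> over \<open>f x y\<close> gives y - a + \<alpha>
      (\<alpha> x). The cube condition at \<open>\<beta> x\<close> turns the last term into a -
      \<beta> x - a, and adding a + \<beta> x leaves \<open>y\<close>.\<close>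
    have "\<alpha> (\<alpha> x) = inv (a \<otimes> \<beta> x \<otimes> inv a)"
      using cube[of "\<beta> x"] xy by (simp add: \<alpha>\<beta>)
    then show "f (f x y) x = y"
      using xy by (simp add: f_eq anti \<alpha>\<beta> \<alpha>a inv_mult_group m_assoc inv_cancel_left)
  qed
qed

end

lemma isotope_decomposition_if_canonical:
  assumes "canonical_decomposition Q f z G \<alpha> a \<beta>"
  shows "isotope_decomposition G f \<alpha> \<beta> a" "carrier G = Q"
  using assms unfolding canonical_decomposition_def
  by (auto simp: isotope_decomposition_def isotope_decomposition_axioms_def)

theorem theorem8:
  fixes Q :: "'a set" and f :: "'a \<Rightarrow> 'a \<Rightarrow> 'a" and z a :: 'a
    and G :: "'a monoid" and \<alpha> \<beta> :: "'a \<Rightarrow> 'a"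
  assumes "group_isotope Q f" and "z \<in> Q"
    and "canonical_decomposition Q f z G \<alpha> a \<beta>"
  shows "(commutative Q f \<longleftrightarrow> comm_group G \<and> eq_maps_on Q \<beta> \<alpha>) \<and>
    (left_symmetric Q f \<longleftrightarrow> comm_group G \<and> eq_maps_on Q \<beta> (\<lambda>x. inv\<^bsub>G\<^esub> x)) \<and>
    (right_symmetric Q f \<longleftrightarrow> comm_group G \<and> eq_maps_on Q \<alpha> (\<lambda>x. inv\<^bsub>G\<^esub> x)) \<and>
    (totally_symmetric Q f \<longleftrightarrow>
       comm_group G \<and> eq_maps_on Q \<alpha> \<beta> \<and> eq_maps_on Q \<beta> (\<lambda>x. inv\<^bsub>G\<^esub> x)) \<and>
    (semi_symmetric Q f \<longleftrightarrow>
       anti_automorphism G \<alpha> \<and> eq_maps_on Q \<beta> (inv_into Q \<alpha>) \<and>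
       eq_maps_on Q (\<alpha> ^^ 3) (\<lambda>x. inv\<^bsub>G\<^esub> (inv_into Q (inner_map G a) x)) \<and>
       \<alpha> a = inv\<^bsub>G\<^esub> a) \<and>
    (asymmetric Q f \<longleftrightarrow>
       (\<not> comm_group G \<or>
          (\<not> eq_maps_on Q \<alpha> (\<lambda>x. inv\<^bsub>G\<^esub> x) \<and> \<not> eq_maps_on Q \<alpha> \<beta> \<and>
           \<not> eq_maps_on Q \<beta> (\<lambda>x. inv\<^bsub>G\<^esub> x))) \<and>
       (\<not> anti_automorphism G \<alpha> \<or> \<not> eq_maps_on Q \<beta> (inv_into Q \<alpha>) \<or>
        \<not> eq_maps_on Q (\<alpha> ^^ 3) (\<lambda>x. inv\<^bsub>G\<^esub> (inv_into Q (inner_map G a) x)) \<or>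
        \<alpha> a \<noteq> inv\<^bsub>G\<^esub> a))"
proof -
  interpret isotope_decomposition G f \<alpha> \<beta> a
    using assms(3) by (rule isotope_decomposition_if_canonical)
  have Q: "carrier G = Q"
    using assms(3) by (rule isotope_decomposition_if_canonical)
  \<comment> \<open>The claims on total symmetry and asymmetry state this equality in the opposite
    orientation to the commutative one.\<close>
  have sym: "eq_maps_on Q \<alpha> \<beta> \<longleftrightarrow> eq_maps_on Q \<beta> \<alpha>"
    by (auto simp: eq_maps_on_def)
  note iffs = commutative_isotope_iff[unfolded Q] left_symmetric_isotope_iff[unfolded Q]
    right_symmetric_isotope_iff[unfolded Q] semi_symmetric_isotope_iff[unfolded Q]
  \<comment> \<open>Total symmetry is a conjunction of two of the four classes and asymmetry the
    negation of all four, so the rest is propositional.\<close>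
  show ?thesis
    unfolding totally_symmetric_iff[OF quasigroup[unfolded Q]]
      asymmetric_iff[OF quasigroup[unfolded Q]] iffs sym
    by blast
qed

end
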